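(* Let $E$ be a uniformly convex Banach space, let $C$ be a nonempty closed convex subset of $E$, and let $T : C \to C$ be a nonexpansive mapping. Let $\{\alpha_n\}_{n\in\mathbb{N}}$ and $\{\beta_n\}_{n\in\mathbb{N}}$ be sequences in $(0,1)$, and let $\{x_n\}$ be defined by $x_1 \in C$ and, for all $n \in \mathbb{N}$, $$x_{n+1} = Ty_n,\qquad y_n = (1-\alpha_n)z_n + \alpha_n Tz_n,\qquad z_n = (1-\beta_n)x_n + \beta_n Tx_n.$$ Then $\{x_n\}$ converges (in norm) to a point of $F(T)$ if and only if $\liminf_{n\to\infty} d(x_n, F(T)) = 0$.
   Context: $\mathbb{N}$ denotes the set of positive integers. $F(T)$ denotes the set of fixed points of $T$, and $d(x,F(T)) = \inf\{\|x-p\| : p \in F(T)\}$. A mapping $T : C\to C$ is nonexpansive if $\|Tx-Ty\| \le \|x-y\|$ for all $x,y\in C$. *)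

theory Defs
  imports "HOL-Analysis.Analysis"
begin

definition uniformly_convex :: "'a::real_normed_vector itself \<Rightarrow> bool" where
  "uniformly_convex _ \<longleftrightarrow>
     (\<forall>\<epsilon>\<in>{0<..2}. \<exists>\<delta>>0. \<forall>x y::'a.
        norm x \<le> 1 \<longrightarrow> norm y \<le> 1 \<longrightarrow> \<epsilon> \<le> norm (x - y) \<longrightarrow>
        norm ((x + y) /\<^sub>R 2) \<le> 1 - \<delta>)"

definition nonexpansive_on :: "'a::real_normed_vector set \<Rightarrow> ('a \<Rightarrow> 'a) \<Rightarrow> bool" where
  "nonexpansive_on C T \<longleftrightarrow> (\<forall>x\<in>C. \<forall>y\<in>C. norm (T x - T y) \<le> norm (x - y))"

definition fixed_points :: "'a set \<Rightarrow> ('a \<Rightarrow> 'a) \<Rightarrow> 'a set" where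
  "fixed_points C T = {p \<in> C. T p = p}"

text \<open>
  The distance takes extended real values, so that the distance to the empty set is the
  infimum of the empty set, which is infinity. The library's real-valued
  \<^const>\<open>infdist\<close> would give 0 there, and the set of fixed points may be empty.
\<close>
definition dist_to_set :: "'a::real_normed_vector \<Rightarrow> 'a set \<Rightarrow> ereal" where
  "dist_to_set x A = (INF p\<in>A. ereal (norm (x - p)))"

end

theory Submission
  imports Defs
begin

text \<open>
  Each iteration step is nonexpansive towards every fixed point, so the sequence never moves away
  from a fixed point. Hence once \<open>x n\<close> is within \<open>e\<close> of some fixed point, the whole tail stays
  within \<open>e\<close> of it; if this happens for every \<open>e > 0\<close>, the sequence is Cauchy, and its limit
  is arbitrarily close to fixed points and so is fixed.
\<close>

lemma nonexpansive_on_fixed_point: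
  assumes "nonexpansive_on C T" "u \<in> C" "p \<in> fixed_points C T"
  shows "norm (T u - p) \<le> norm (u - p)"
  using assms unfolding nonexpansive_on_def fixed_points_def by force

text \<open>Both \<open>u\<close> and \<open>T u\<close> lie in the closed ball around
  \<open>p\<close> of radius \<open>norm (u - p)\<close>, and balls are convex.\<close>

lemma averaged_step_fixed_point:
  assumes "nonexpansive_on C T" "u \<in> C" "p \<in> fixed_points C T" "0 \<le> t" "t \<le> 1"
  shows "norm ((1 - t) *\<^sub>R u + t *\<^sub>R T u - p) \<le> norm (u - p)"
proof -
  have "u \<in> cball p (norm (u - p))" "T u \<in> cball p (norm (u - p))"
    using nonexpansive_on_fixed_point[OF assms(1-3)] by (auto simp: dist_norm norm_minus_commute)
  then have "(1 - t) *\<^sub>R u + t *\<^sub>R T u \<in> cball p (norm (u - p))"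
    using convexD_alt[OF convex_cball] assms(4,5) by blast
  then show ?thesis by (simp add: dist_norm norm_minus_commute)
qed

lemma averaged_step_in:
  assumes "convex C" "T \<in> C \<rightarrow> C" "u \<in> C" "0 \<le> t" "t \<le> 1"
  shows "(1 - t) *\<^sub>R u + t *\<^sub>R T u \<in> C"
  using assms by (intro convexD_alt) auto

text \<open>A fixed point \<open>p\<close> within \<open>e / 2\<close> of \<open>q\<close> is also
  within \<open>e / 2\<close> of \<open>T q\<close>, so \<open>T q\<close> and \<open>q\<close> are
  at most \<open>e\<close> apart for every \<open>e > 0\<close>.\<close>

lemma fixed_if_near_fixed_points:
  assumes "nonexpansive_on C T" "q \<in> C"
    and near: "\<And>e. e > 0 \<Longrightarrow> \<exists>p\<in>fixed_points C T. norm (q - p) \<le> e"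
  shows "q \<in> fixed_points C T"
proof -
  have "norm (T q - q) \<le> 0"
  proof (rule field_le_epsilon)
    fix e :: real assume "e > 0"
    then obtain p where p: "p \<in> fixed_points C T" "norm (q - p) \<le> e / 2"
      using near[of "e / 2"] by auto
    have "norm (T q - q) \<le> norm (T q - p) + norm (q - p)"
      by (metis dist_norm dist_triangle2)
    then show "norm (T q - q) \<le> 0 + e"
      using nonexpansive_on_fixed_point[OF assms(1,2) p(1)] p(2) by linarith
  qed
  then show ?thesis using \<open>q \<in> C\<close> by (simp add: fixed_points_def)
qed

lemma dist_to_set_nonneg: "0 \<le> dist_to_set u A"
  unfolding dist_to_set_def by (auto intro: INF_greatest)

text \<open>The distance is squeezed between 0 and \<open>norm (x n - p)\<close>.\<close>

lemma liminf_dist_to_set_eq_0: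
  assumes "p \<in> A" "x \<longlonglongrightarrow> p"
  shows "liminf (\<lambda>n. dist_to_set (x n) A) = 0"
proof -
  have "(\<lambda>n. norm (x n - p)) \<longlonglongrightarrow> 0"
    using assms(2) by (simp add: LIM_zero tendsto_norm_zero)
  then have lim: "(\<lambda>n. ereal (norm (x n - p))) \<longlonglongrightarrow> 0"
    by (simp add: zero_ereal_def)
  have "dist_to_set (x n) A \<le> ereal (norm (x n - p))" for n
    unfolding dist_to_set_def using assms(1) by (rule INF_lower)
  then have "(\<lambda>n. dist_to_set (x n) A) \<longlonglongrightarrow> 0"
    by (intro tendsto_sandwich[OF _ _ tendsto_const lim]) (auto simp: dist_to_set_nonneg)
  then show ?thesis by (simp add: lim_imp_Liminf)
qed

text \<open>Otherwise \<open>e\<close> bounds the distance from below from \<open>N\<close> on, and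
  hence bounds the liminf. This covers empty \<open>A\<close> too: the distance is then infinite, so
  a liminf of 0 yields a point of \<open>A\<close>.\<close>

lemma liminf_dist_to_set_eq_0_D:
  assumes "liminf (\<lambda>n. dist_to_set (x n) A) = 0" "e > 0"
  obtains n p where "n \<ge> N" "p \<in> A" "norm (x n - p) < e"
proof (rule ccontr)
  assume "\<not> thesis"
  then have "\<forall>n\<ge>N. ereal e \<le> dist_to_set (x n) A"
    unfolding dist_to_set_def using that by (force intro!: INF_greatest)
  then have "ereal e \<le> liminf (\<lambda>n. dist_to_set (x n) A)"
    by (intro Liminf_bounded) (auto simp: eventually_sequentially)
  then show False using assms by simp
qed

theorem theorem9:
  fixes C :: "'a::banach set"
    and T :: "'a \<Rightarrow> 'a"
    and \<alpha> \<beta> :: "nat \<Rightarrow> real"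
    and x y z :: "nat \<Rightarrow> 'a"
  assumes "uniformly_convex TYPE('a)"
    and "C \<noteq> {}" and "closed C" and "convex C"
    and "T \<in> C \<rightarrow> C" and "nonexpansive_on C T"
    and "\<And>n. n \<ge> 1 \<Longrightarrow> \<alpha> n \<in> {0<..<1}"
    and "\<And>n. n \<ge> 1 \<Longrightarrow> \<beta> n \<in> {0<..<1}"
    and "x 1 \<in> C"
    and "\<And>n. n \<ge> 1 \<Longrightarrow> x (n + 1) = T (y n)"
    and "\<And>n. n \<ge> 1 \<Longrightarrow> y n = (1 - \<alpha> n) *\<^sub>R z n + \<alpha> n *\<^sub>R T (z n)"
    and "\<And>n. n \<ge> 1 \<Longrightarrow> z n = (1 - \<beta> n) *\<^sub>R x n + \<beta> n *\<^sub>R T (x n)"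
  shows "(\<exists>p \<in> fixed_points C T. x \<longlonglongrightarrow> p) \<longleftrightarrow>
         liminf (\<lambda>n. dist_to_set (x n) (fixed_points C T)) = 0"
proof
  assume "\<exists>p \<in> fixed_points C T. x \<longlonglongrightarrow> p"
  then show "liminf (\<lambda>n. dist_to_set (x n) (fixed_points C T)) = 0"
    using liminf_dist_to_set_eq_0 by blast
next
  assume lim0: "liminf (\<lambda>n. dist_to_set (x n) (fixed_points C T)) = 0"
  note ne = \<open>nonexpansive_on C T\<close>
  have par: "0 \<le> \<alpha> n" "\<alpha> n \<le> 1" "0 \<le> \<beta> n" "\<beta> n \<le> 1" if "n \<ge> 1" for n
    using assms(7,8)[OF that] by auto
  have zC: "z n \<in> C" if "n \<ge> 1" "x n \<in> C" for n
    using averaged_step_in[OF assms(4,5) that(2)] par[OF that(1)] assms(12)[OF that(1)] by simp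
  have yC: "y n \<in> C" if "n \<ge> 1" "x n \<in> C" for n
    using averaged_step_in[OF assms(4,5) zC[OF that]] par[OF that(1)] assms(11)[OF that(1)] by simp
  have xC: "x n \<in> C" if "n \<ge> 1" for n
    using that
  proof (induction n rule: nat_induct_at_least)
    case base
    show ?case by fact
  next
    case (Suc n)
    then show ?case using yC[of n] assms(5,10) by auto
  qed
  \<comment> \<open>Fejer monotonicity: the two averagings and the final application of
    \<open>T\<close> are each nonexpansive towards \<open>p\<close>.\<close>
  have closer: "norm (x (Suc n) - p) \<le> norm (x n - p)"
    if n: "n \<ge> 1" and p: "p \<in> fixed_points C T" for n p
  proof -
    have "norm (x (Suc n) - p) \<le> norm (y n - p)"
      using nonexpansive_on_fixed_point[OF ne yC[OF n xC[OF n]] p] assms(10)[OF n] by simp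
    also have "\<dots> \<le> norm (z n - p)"
      using averaged_step_fixed_point[OF ne zC[OF n xC[OF n]] p] par[OF n] assms(11)[OF n] by simp
    also have "\<dots> \<le> norm (x n - p)"
      using averaged_step_fixed_point[OF ne xC[OF n] p] par[OF n] assms(12)[OF n] by simp
    finally show ?thesis .
  qed
  have tail: "\<exists>n p. p \<in> fixed_points C T \<and> (\<forall>m\<ge>n. norm (x m - p) < e)" if "e > 0" for e
  proof -
    \<comment> \<open>The threshold \<open>N\<close> is taken to be 1, because the recursion says
      nothing about \<open>x 0\<close>.\<close>
    obtain n p where n: "n \<ge> 1" and p: "p \<in> fixed_points C T" and less: "norm (x n - p) < e"
      by (rule liminf_dist_to_set_eq_0_D[OF lim0 \<open>e > 0\<close>])
    have "norm (x m - p) < e" if "m \<ge> n" for m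
      using that
    proof (induction m rule: dec_induct)
      case base
      show ?case by fact
    next
      case (step m)
      then show ?case using closer[of m p] n p by linarith
    qed
    then show ?thesis using p by blast
  qed
  have "Cauchy x"
  proof (rule metric_CauchyI)
    fix e :: real assume "e > 0"
    \<comment> \<open>Any two terms of the tail are compared through the same \<open>p\<close>,
      hence \<open>e / 2\<close>.\<close>
    then obtain n p where "\<forall>m\<ge>n. norm (x m - p) < e / 2"
      using tail[of "e / 2"] by auto
    then have "\<forall>k\<ge>n. \<forall>m\<ge>n. dist (x k) (x m) < e"
      by (metis dist_norm dist_triangle_half_l)
    then show "\<exists>M. \<forall>k\<ge>M. \<forall>m\<ge>M. dist (x k) (x m) < e" by blast
  qed
  then obtain q where q: "x \<longlonglongrightarrow> q"
    using Cauchy_convergent convergent_def by blast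
  \<comment> \<open>\<open>x 0\<close> may lie outside \<open>C\<close>, so membership is only used
    eventually.\<close>
  have "q \<in> C"
    by (rule Lim_in_closed_set[OF \<open>closed C\<close> _ _ q])
      (auto simp: eventually_sequentially intro: xC)
  moreover have "\<exists>p\<in>fixed_points C T. norm (q - p) \<le> e" if "e > 0" for e
  proof -
    obtain n p where p: "p \<in> fixed_points C T" and le: "\<forall>m\<ge>n. norm (x m - p) < e"
      using tail[OF \<open>e > 0\<close>] by blast
    \<comment> \<open>The strict bound on the tail becomes non-strict in the limit;
      \<open>fixed_if_near_fixed_points\<close> asks for no more.\<close>
    have "norm (q - p) \<le> e"
      by (rule Lim_bounded[OF tendsto_norm[OF tendsto_diff[OF q tendsto_const]], of n])
        (use le in \<open>auto intro: less_imp_le\<close>)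
    then show ?thesis using p by blast
  qed
  ultimately have "q \<in> fixed_points C T"
    using fixed_if_near_fixed_points[OF ne] by blast
  then show "\<exists>p \<in> fixed_points C T. x \<longlonglongrightarrow> p" using q by blast
qed

end
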